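(* Let $k$ be a positive integer and let $\alpha,\beta\in[0,2\pi]$ with $e^{i\alpha}\neq e^{i\beta}$. Let $|\alpha-\beta|$ denote the length of the (shorter) arc between $e^{i\alpha}$ and $e^{i\beta}$ on the unit circle $\mathbb{S}^1$. Then the line segment $[SM_{2k}(\alpha),SM_{2k}(\beta)]$ is an exposed edge of $B_{2k}$ if $|\alpha-\beta|<\frac{2\pi(k-1)}{2k-1}$, and is not an edge of $B_{2k}$ if $|\alpha-\beta|>\frac{2\pi(k-1)}{2k-1}$.
   Context: For a positive integer $k$, the symmetric trigonometric moment curve is $SM_{2k}:\mathbb{R}\to\mathbb{R}^{2k}$, $$SM_{2k}(\theta)=(\cos(\theta),\cos(3\theta),\ldots,\cos((2k-1)\theta),\sin(\theta),\sin(3\theta),\ldots,\sin((2k-1)\theta)),$$ and $B_{2k}=\operatorname{conv}(SM_{2k}([0,2\pi]))$ is its convex hull (the Barvinok-Novik orbitope). A face of a convex body $B$ is a convex subset $F\subseteq B$ such that whenever an interior point of a line segment contained in $B$ lies in $F$, the whole segment lies in $F$. An edge is a one-dimensional face. An exposed edge is an edge that equals the intersection of $B$ with a supporting hyperplane. $[p,q]$ denotes the closed line segment between $p$ and $q$. *)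

theory Defs
  imports "HOL-Analysis.Analysis"
begin

text \<open>
  The space \<open>\<real>\<^sup>2\<^sup>k\<close> is \<open>real ^ 'n\<close> for a finite linearly ordered index type with
  \<open>CARD('n) = 2 * k\<close>; \<open>coord_pos i\<close> is the position of the coordinate \<open>i\<close>, counted from 0.
\<close>

definition coord_pos :: "'n::{finite,linorder} \<Rightarrow> nat" where
  "coord_pos i = card {j. j < i}"

text \<open>
  With positions counted from 0, the entry at position \<open>p < k\<close> is \<open>cos ((2p+1)\<theta>)\<close>, and the
  entry at position \<open>k + p\<close> is \<open>sin ((2p+1)\<theta>)\<close>. Only meaningful when \<open>CARD('n) = 2 * k\<close>.
\<close>

definition SM :: "nat \<Rightarrow> real \<Rightarrow> real ^ 'n::{finite,linorder}" where
  "SM k \<theta> = (\<chi> i. let p = coord_pos i in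
     if p < k then cos (real (2 * p + 1) * \<theta>)
     else sin (real (2 * (p - k) + 1) * \<theta>))"

definition orbitope :: "nat \<Rightarrow> (real ^ 'n::{finite,linorder}) set" where
  "orbitope k = convex hull (SM k ` {0..2 * pi})"

text \<open>
  The condition \<open>a \<noteq> 0\<close>, absent from \<^const>\<open>exposed_face_of\<close>, ensures that \<open>{x. a \<bullet> x = b}\<close>
  is a hyperplane.
\<close>

definition exposed_edge_of :: "'a::euclidean_space set \<Rightarrow> 'a set \<Rightarrow> bool"
    (infixr \<open>(exposed'_edge'_of)\<close> 50) where
  "e exposed_edge_of S \<longleftrightarrow> e edge_of S \<and>
     (\<exists>a b. a \<noteq> 0 \<and> S \<subseteq> {x. a \<bullet> x \<le> b} \<and> e = S \<inter> {x. a \<bullet> x = b})"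

text \<open>
  For \<open>\<alpha>, \<beta> \<in> [0, 2\<pi>]\<close> the points \<open>cis \<alpha>\<close> and \<open>cis \<beta>\<close> divide the unit circle into two arcs:
  one swept by the angles between \<open>\<alpha>\<close> and \<open>\<beta>\<close>, of length \<open>\<bar>\<alpha> - \<beta>\<bar>\<close>, and the
  complementary one. The definition is not intended for other angles.
\<close>

definition shorter_arc_length :: "real \<Rightarrow> real \<Rightarrow> real" where
  "shorter_arc_length \<alpha> \<beta> = min \<bar>\<alpha> - \<beta>\<bar> (2 * pi - \<bar>\<alpha> - \<beta>\<bar>)"

end

theory Submission
  imports Defs "HOL-Computational_Algebra.Polynomial"
begin

text \<open>
  Put \<open>N = 2 k - 1\<close> and let \<open>c \<plusminus> t\<close> be the two angles, so that the threshold reads \<open>t = \<phi>\<close> with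
  \<open>\<phi> = (k - 1) \<pi> / N\<close>. Functions \<open>C + a \<bullet> SM k \<theta>\<close> that are even about \<open>c\<close> are the polynomials
  \<open>C + p x\<close> in \<open>x = cos (\<theta> - c)\<close> with \<open>p\<close> odd of degree at most \<open>N\<close>, and \<open>cos \<phi>\<close> is the smallest
  positive extremal point of the Chebyshev polynomial \<open>T\<close> of degree \<open>N\<close>.

  If \<open>cos t > cos \<phi>\<close>, then \<open>1 \<plusminus> T (x cos \<phi> / cos t)\<close> is nonnegative on \<open>[-1, 1]\<close> with a
  nondegenerate zero at \<open>cos t\<close>; a small perturbation removes its other zeros, and the resulting
  functional exposes the segment.

  If \<open>cos t < cos \<phi>\<close>, interpolation at the positive extremal points of \<open>T\<close> writes the midpoint of
  the segment as a convex combination of midpoints of pairs \<open>SM k (c \<plusminus> \<psi>)\<close>. If the segment were a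
  face, it would contain such points of the curve; but the curve lies on a sphere, so it meets the
  segment only in the two endpoints.
\<close>

subsection \<open>The moment curve\<close>

lemma bij_betw_coord_pos:
  "bij_betw (coord_pos :: 'n::{finite,linorder} \<Rightarrow> nat) UNIV {..<CARD('n)}"
proof -
  have "coord_pos i < coord_pos j" if "i < j" for i j :: 'n
    unfolding coord_pos_def using that by (intro psubset_card_mono) auto
  then have inj: "inj (coord_pos :: 'n \<Rightarrow> nat)"
    by (metis injI linorder_neq_iff order_less_irrefl)
  have "coord_pos i < CARD('n)" for i :: 'n
    unfolding coord_pos_def by (intro psubset_card_mono) auto
  then have "range (coord_pos :: 'n \<Rightarrow> nat) \<subseteq> {..<CARD('n)}" by auto
  with inj show ?thesis
    by (metis bij_betw_def card_image card_lessThan card_subset_eq finite_lessThan)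
qed

text \<open>One form for curve points and linear functionals alike: cosine entries first, then sine
  entries, so that inner products become sums over the odd frequencies
  \<open>2 * p + 1\<close>.\<close>

definition coeff_vec :: "nat \<Rightarrow> (nat \<Rightarrow> real) \<Rightarrow> (nat \<Rightarrow> real) \<Rightarrow> real ^ 'n::{finite,linorder}" where
  "coeff_vec k a b = (\<chi> i. if coord_pos i < k then a (coord_pos i) else b (coord_pos i - k))"

lemma SM_coeff_vec:
  "SM k \<theta> = coeff_vec k (\<lambda>p. cos (real (2 * p + 1) * \<theta>)) (\<lambda>p. sin (real (2 * p + 1) * \<theta>))"
  unfolding SM_def coeff_vec_def Let_def ..

lemma inner_coeff_vec:
  assumes "CARD('n::{finite,linorder}) = 2 * k"
  shows "coeff_vec k a b \<bullet> (coeff_vec k c d :: real ^ 'n::{finite,linorder}) = (\<Sum>p<k. a p * c p + b p * d p)"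
proof -
  define h where "h p = (if p < k then a p * c p else b (p - k) * d (p - k))" for p
  have "coeff_vec k a b \<bullet> (coeff_vec k c d :: real ^ 'n::{finite,linorder}) = (\<Sum>i\<in>(UNIV :: 'n set). h (coord_pos i))"
    by (auto simp: inner_vec_def coeff_vec_def h_def intro!: sum.cong)
  also have "\<dots> = sum h {..<k + k}"
    using sum.reindex_bij_betw[OF bij_betw_coord_pos[where 'n='n], of h] assms by (simp add: mult_2)
  also have "\<dots> = (\<Sum>p<k. a p * c p) + (\<Sum>p<k. b p * d p)"
    by (simp add: sum.nat_group[symmetric] lessThan_atLeast0 sum.atLeastLessThan_concat[of 0 k "k+k", symmetric]
        h_def sum.shift_bounds_nat_ivl[of _ 0 k k, simplified])
  finally show ?thesis by (simp add: sum.distrib)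
qed

lemma coeff_vec_eq_iff:
  assumes "CARD('n::{finite,linorder}) = 2 * k"
  shows "coeff_vec k a b = (coeff_vec k c d :: real ^ 'n::{finite,linorder}) \<longleftrightarrow> (\<forall>p<k. a p = c p \<and> b p = d p)"
proof -
  have "coeff_vec k a b = (coeff_vec k c d :: real ^ 'n::{finite,linorder}) \<longleftrightarrow>
      (\<forall>p\<in>range (coord_pos :: 'n \<Rightarrow> nat). if p < k then a p = c p else b (p - k) = d (p - k))"
    by (auto simp: coeff_vec_def vec_eq_iff)
  also have "range (coord_pos :: 'n \<Rightarrow> nat) = {..<2 * k}"
    using bij_betw_coord_pos[where 'n='n] assms by (simp add: bij_betw_def)
  also have "(\<forall>p\<in>{..<2 * k}. if p < k then a p = c p else b (p - k) = d (p - k)) \<longleftrightarrow>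
      (\<forall>p<k. a p = c p \<and> b p = d p)" (is "?l \<longleftrightarrow> ?r")
  proof
    assume l: ?l
    show ?r
    proof (intro allI impI conjI)
      fix p assume "p < k"
      then show "a p = c p" "b p = d p" using bspec[OF l, of p] bspec[OF l, of "p + k"] by auto
    qed
  qed auto
  finally show ?thesis .
qed

text \<open>Each frequency contributes \<open>cos^2 + sin^2 = 1\<close>, so the curve lies on the
  sphere of radius \<open>sqrt k\<close> about 0.\<close>

lemma inner_SM_self:
  assumes "CARD('n::{finite,linorder}) = 2 * k"
  shows "(SM k \<theta> :: real ^ 'n::{finite,linorder}) \<bullet> SM k \<theta> = k"
  by (simp add: SM_coeff_vec inner_coeff_vec[OF assms] flip: power2_eq_square)

lemma SM_cong_cis:
  assumes "cis \<theta> = cis \<phi>"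
  shows "SM k \<theta> = SM k \<phi>"
proof -
  have "cis (real m * \<theta>) = cis (real m * \<phi>)" for m
    unfolding Complex.DeMoivre[symmetric] using assms by simp
  then have "cos (real m * \<theta>) = cos (real m * \<phi>)" "sin (real m * \<theta>) = sin (real m * \<phi>)" for m
    by (simp_all add: complex_eq_iff)
  then show ?thesis unfolding SM_coeff_vec by presburger
qed

text \<open>Position \<open>p = 0\<close> has frequency 1 and already recovers cosine and sine of
  the angle; conversely, all frequencies are integers.\<close>

lemma SM_eq_iff:
  assumes "CARD('n::{finite,linorder}) = 2 * k" "k \<ge> 1"
  shows "(SM k \<theta> :: real ^ 'n::{finite,linorder}) = SM k \<phi> \<longleftrightarrow> cis \<theta> = cis \<phi>"
proof
  assume "(SM k \<theta> :: real ^ 'n::{finite,linorder}) = SM k \<phi>"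
  then show "cis \<theta> = cis \<phi>"
    using assms(2) unfolding SM_coeff_vec coeff_vec_eq_iff[OF assms(1)]
    by (auto simp: complex_eq_iff dest: spec[of _ 0])
qed (rule SM_cong_cis)

text \<open>Frees the argument from the interval: angles such as \<open>c + \<phi>\<close> may then
  be arbitrary reals.\<close>

lemma range_SM: "range (SM k) = SM k ` {0..2 * pi}"
proof (intro equalityI image_subsetI)
  fix \<theta>
  obtain \<phi> where "0 \<le> \<phi>" "\<phi> < 2 * pi" "cos \<theta> = cos \<phi>" "sin \<theta> = sin \<phi>"
    using sincos_total_2pi[of "cos \<theta>" "sin \<theta>"] by auto
  then have "SM k \<theta> = SM k \<phi>" by (intro SM_cong_cis) (simp add: complex_eq_iff)
  with \<open>0 \<le> \<phi>\<close> \<open>\<phi> < 2 * pi\<close> show "SM k \<theta> \<in> SM k ` {0..2 * pi}" by auto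
qed auto

lemma SM_in_orbitope: "SM k \<theta> \<in> orbitope k"
  unfolding orbitope_def by (metis hull_inc range_SM rangeI)

text \<open>A ball is strictly convex: a point inside a chord is nearer to the centre than one of
  the ends of the chord, while all points of the curve have the same distance from 0.\<close>

lemma SM_in_segment:
  assumes "CARD('n::{finite,linorder}) = 2 * k" "k \<ge> 1"
    and "(SM k \<theta> :: real ^ 'n::{finite,linorder}) \<in> closed_segment (SM k \<alpha>) (SM k \<beta>)"
  shows "cis \<theta> = cis \<alpha> \<or> cis \<theta> = cis \<beta>"
proof (rule ccontr)
  assume "\<not> ?thesis"
  then have "(SM k \<theta> :: real ^ 'n::{finite,linorder}) \<in> open_segment (SM k \<alpha>) (SM k \<beta>)"
    using assms by (auto simp: open_segment_def SM_eq_iff)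
  from dist_decreases_open_segment[OF this, of 0] show False
    by (simp add: norm_eq_sqrt_inner inner_SM_self[OF assms(1)])
qed

subsection \<open>Faces and convex combinations\<close>

text \<open>The definition of a face speaks of two points only. The terms other than
  \<open>j\<close> are therefore collected into one point \<open>y\<close> of \<open>S\<close>,
  which puts the sum on the open segment from \<open>y\<close> to \<open>x j\<close>. The degenerate
  cases \<open>w j = 1\<close> and \<open>y = x j\<close> are separate.\<close>

lemma face_of_convex_combination:
  assumes "T face_of S" "finite I" "\<And>i. i \<in> I \<Longrightarrow> x i \<in> S" "\<And>i. i \<in> I \<Longrightarrow> w i \<ge> 0"
    "convex S" "sum w I = 1" "(\<Sum>i\<in>I. w i *\<^sub>R x i) \<in> T" "j \<in> I" "w j > 0"
  shows "x j \<in> T"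
proof (cases "w j = 1")
  case True
  have "sum w (I - {j}) = 0" using assms by (simp add: sum_diff1 True)
  then have "\<forall>i\<in>I - {j}. w i = 0"
    using assms by (subst (asm) sum_nonneg_eq_0_iff) auto
  then have "(\<Sum>i\<in>I. w i *\<^sub>R x i) = x j"
    using assms True by (subst sum.remove[of _ j]) auto
  then show ?thesis using assms by simp
next
  case False
  define y where "y = (\<Sum>i\<in>I - {j}. (w i / (1 - w j)) *\<^sub>R x i)"
  have sum': "sum w (I - {j}) = 1 - w j" using assms by (simp add: sum_diff1)
  have "sum w (I - {j}) \<ge> 0" using assms(4) by (intro sum_nonneg) auto
  then have w: "w j < 1" using sum' False by linarith
  have "y \<in> S" unfolding y_def
  proof (rule convex_sum)
    show "(\<Sum>i\<in>I - {j}. w i / (1 - w j)) = 1"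
      using w by (simp add: sum_divide_distrib[symmetric] sum')
  qed (use assms(2-5) w in auto)
  have "(\<Sum>i\<in>I. w i *\<^sub>R x i) = w j *\<^sub>R x j + (\<Sum>i\<in>I - {j}. w i *\<^sub>R x i)"
    using assms(2,8) by (rule sum.remove)
  also have "(\<Sum>i\<in>I - {j}. w i *\<^sub>R x i) = (1 - w j) *\<^sub>R y"
    using w by (simp add: y_def scaleR_sum_right)
  finally have eq: "(1 - w j) *\<^sub>R y + w j *\<^sub>R x j \<in> T" using assms(7) by (simp add: add.commute)
  show ?thesis
  proof (cases "y = x j")
    case True
    have "(1 - w j) *\<^sub>R y + w j *\<^sub>R x j = x j"
      unfolding True scaleR_left_distrib[symmetric] by simp
    then show ?thesis using eq by simp
  next
    case False
    then have "(1 - w j) *\<^sub>R y + w j *\<^sub>R x j \<in> open_segment y (x j)"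
      using w assms(9) unfolding in_segment by blast
    from face_ofD[OF assms(1) this] show ?thesis using eq assms(3,8) \<open>y \<in> S\<close> by blast
  qed
qed

section \<open>Sums over symmetric pairs of curve points\<close>

lemma SM_add_SM_diff:
  "SM k (c + \<phi>) + SM k (c - \<phi>) =
    coeff_vec k (\<lambda>p. 2 * cos (real (2 * p + 1) * c) * cos (real (2 * p + 1) * \<phi>))
      (\<lambda>p. 2 * sin (real (2 * p + 1) * c) * cos (real (2 * p + 1) * \<phi>))"
proof -
  have "cos (m * (c + \<phi>)) + cos (m * (c - \<phi>)) = 2 * cos (m * c) * cos (m * \<phi>)"
    "sin (m * (c + \<phi>)) + sin (m * (c - \<phi>)) = 2 * sin (m * c) * cos (m * \<phi>)" for m :: real
    by (simp_all add: distrib_left right_diff_distrib cos_add cos_diff sin_add sin_diff)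
  then show ?thesis
    unfolding SM_coeff_vec by (simp add: coeff_vec_def vec_eq_iff del: of_nat_mult of_nat_add)
qed

text \<open>The angle enters the sum of a symmetric pair only through its cosines at the odd
  frequencies, so linear relations between these cosines carry over to the vectors, whatever the
  centre \<open>c\<close>.\<close>

lemma sum_SM_add_SM_diff:
  fixes w :: "'i \<Rightarrow> real"
  assumes "CARD('n::{finite,linorder}) = 2 * k"
    and "\<And>p. p < k \<Longrightarrow> (\<Sum>i\<in>I. w i * cos (real (2 * p + 1) * \<phi> i)) = cos (real (2 * p + 1) * t)"
  shows "(\<Sum>i\<in>I. w i *\<^sub>R (SM k (c + \<phi> i) + SM k (c - \<phi> i))) =
    (SM k (c + t) + SM k (c - t) :: real ^ 'n::{finite,linorder})"
proof -
  have "(\<Sum>i\<in>I. w i *\<^sub>R (SM k (c + \<phi> i) + SM k (c - \<phi> i))) =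
     (coeff_vec k (\<lambda>p. 2 * cos (real (2 * p + 1) * c) * (\<Sum>i\<in>I. w i * cos (real (2 * p + 1) * \<phi> i)))
      (\<lambda>p. 2 * sin (real (2 * p + 1) * c) * (\<Sum>i\<in>I. w i * cos (real (2 * p + 1) * \<phi> i)))
        :: real ^ 'n::{finite,linorder})"
    unfolding SM_add_SM_diff
    by (auto simp: coeff_vec_def vec_eq_iff sum_distrib_left mult.left_commute
        simp del: of_nat_mult of_nat_add intro!: sum.cong)
  also have "\<dots> = SM k (c + t) + SM k (c - t)"
    unfolding SM_add_SM_diff using assms(2) by (subst coeff_vec_eq_iff[OF assms(1)]) simp
  finally show ?thesis .
qed

subsection \<open>Odd cosine polynomials\<close>

text \<open>The Chebyshev polynomial of degree \<open>2 * i + 1\<close> is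
  \<open>x * q (x^2)\<close> with \<open>q = odd_cheb i\<close>. The recurrence is
  \<open>T_(n+2) + T_(n-2) = 2 * T_2 * T_n\<close>, where
  \<open>2 * T_2 = 4 * x^2 - 2\<close>.\<close>

fun odd_cheb :: "nat \<Rightarrow> real poly" where
  "odd_cheb 0 = 1"
| "odd_cheb (Suc 0) = [:-3, 4:]"
| "odd_cheb (Suc (Suc i)) = [:-2, 4:] * odd_cheb (Suc i) - odd_cheb i"

lemma degree_odd_cheb: "degree (odd_cheb i) \<le> i"
proof (induction i rule: odd_cheb.induct)
  case (3 i)
  have "degree ([:-2, 4:] * odd_cheb (Suc i)) \<le> Suc (Suc i)"
    using degree_mult_le[of "[:-2, 4:]" "odd_cheb (Suc i)"] 3 by simp
  then show ?case using 3 by (auto intro!: degree_diff_le)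
qed auto

lemma coeff_odd_cheb: "coeff (odd_cheb i) i = 4 ^ i"
proof (induction i rule: odd_cheb.induct)
  case (3 i)
  have "coeff (odd_cheb (Suc i)) (Suc (Suc i)) = 0" "coeff (odd_cheb i) (Suc (Suc i)) = 0"
    using degree_odd_cheb[of i] degree_odd_cheb[of "Suc i"] by (auto intro!: coeff_eq_0)
  then show ?case using 3 by simp
qed auto

text \<open>Induction in steps of \<open>2 * x\<close>, by
  \<open>cos (y + 2 * x) + cos (y - 2 * x) = 2 * cos (2 * x) * cos y\<close>.\<close>

lemma cos_odd_multiple: "cos (real (2 * i + 1) * x) = cos x * poly (odd_cheb i) ((cos x)\<^sup>2)"
proof (induction i rule: odd_cheb.induct)
  case 2
  show ?case using cos_treble_cos[of x] by (simp add: power2_eq_square power3_eq_cube algebra_simps)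
next
  case (3 i)
  define y where "y = real (2 * Suc i + 1) * x"
  have y: "real (2 * Suc (Suc i) + 1) * x = y + 2 * x" "real (2 * i + 1) * x = y - 2 * x"
    by (simp_all add: y_def algebra_simps)
  have "cos (y + 2 * x) = 2 * cos (2 * x) * cos y - cos (y - 2 * x)"
    by (simp add: cos_add cos_diff)
  also have "\<dots> = (4 * (cos x)\<^sup>2 - 2) * cos y - cos (y - 2 * x)"
    by (simp add: cos_double_cos)
  also have "\<dots> = cos x * poly (odd_cheb (Suc (Suc i))) ((cos x)\<^sup>2)"
    unfolding 3(1)[folded y_def] 3(2)[unfolded y] by (simp add: algebra_simps)
  finally show ?case unfolding y .
qed auto

text \<open>Since \<open>odd_cheb i\<close> has the nonzero coefficient \<open>4 ^ i\<close> in
  degree \<open>i\<close>, subtracting a multiple of it removes the top coefficient of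
  \<open>R\<close> and lowers the degree bound.\<close>

lemma odd_poly_cos_expansion:
  fixes R :: "real poly"
  assumes "degree R \<le> d"
  shows "\<exists>c. \<forall>x. cos x * poly R ((cos x)\<^sup>2) = (\<Sum>i\<le>d. c i * cos (real (2 * i + 1) * x))"
  using assms
proof (induction d arbitrary: R)
  case 0
  then obtain a where "R = [:a:]" by (metis degree_0_id le_zero_eq)
  then show ?case by (intro exI[of _ "\<lambda>_. a"]) simp
next
  case (Suc d)
  define b where "b = coeff R (Suc d) / 4 ^ Suc d"
  define R' where "R' = R - smult b (odd_cheb (Suc d))"
  have "degree R' \<le> d"
  proof (rule degree_le, intro allI impI)
    fix j assume "d < j"
    then consider "j = Suc d" | "j > Suc d" by linarith
    then show "coeff R' j = 0"
    proof cases
      case 1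
      then show ?thesis by (simp add: R'_def b_def coeff_odd_cheb del: odd_cheb.simps)
    next
      case 2
      then have "coeff R j = 0" "coeff (odd_cheb (Suc d)) j = 0"
        using Suc.prems degree_odd_cheb[of "Suc d"] by (auto intro!: coeff_eq_0)
      then show ?thesis by (simp add: R'_def del: odd_cheb.simps)
    qed
  qed
  from Suc.IH[OF this] obtain c
    where c: "\<And>x. cos x * poly R' ((cos x)\<^sup>2) = (\<Sum>i\<le>d. c i * cos (real (2 * i + 1) * x))" by blast
  have "cos x * poly R ((cos x)\<^sup>2) = (\<Sum>i\<le>Suc d. (c(Suc d := b)) i * cos (real (2 * i + 1) * x))" for x
  proof -
    have "cos x * poly R ((cos x)\<^sup>2) =
        cos x * poly R' ((cos x)\<^sup>2) + b * (cos x * poly (odd_cheb (Suc d)) ((cos x)\<^sup>2))"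
      by (simp add: R'_def algebra_simps del: odd_cheb.simps)
    also have "\<dots> = (\<Sum>i\<le>d. c i * cos (real (2 * i + 1) * x)) + b * cos (real (2 * Suc d + 1) * x)"
      unfolding c cos_odd_multiple[of "Suc d"] ..
    also have "(\<Sum>i\<le>d. c i * cos (real (2 * i + 1) * x)) =
        (\<Sum>i\<le>d. (c(Suc d := b)) i * cos (real (2 * i + 1) * x))"
      by (intro sum.cong) auto
    finally show ?thesis by (simp only: sum.atMost_Suc fun_upd_same)
  qed
  then show ?case by blast
qed

text \<open>Both sides are polynomials in \<open>x\<close> of degree below \<open>card A\<close>
  that agree at \<open>card A\<close> distinct nodes. \<open>L\<close> is the right-hand side as a
  formal polynomial, so that its degree can be bounded.\<close>

lemma lagrange_interpolation:
  fixes q :: "'a::field poly"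
  assumes "finite A" "inj_on z A" "degree q < card A"
  shows "poly q x = (\<Sum>j\<in>A. poly q (z j) * (\<Prod>i\<in>A - {j}. (x - z i) / (z j - z i)))"
proof -
  define L where "L = (\<Sum>j\<in>A. smult (poly q (z j)) (\<Prod>i\<in>A - {j}. smult (1 / (z j - z i)) [:- z i, 1:]))"
  have L: "poly L y = (\<Sum>j\<in>A. poly q (z j) * (\<Prod>i\<in>A - {j}. (y - z i) / (z j - z i)))" for y
    by (simp add: L_def poly_sum poly_prod diff_divide_distrib)
  have agree: "poly L (z m) = poly q (z m)" if "m \<in> A" for m
  proof -
    have "(\<Prod>i\<in>A - {j}. (z m - z i) / (z j - z i)) = (if j = m then 1 else 0)" if "j \<in> A" for j
    proof (cases "j = m")
      case True
      have "(z m - z i) / (z j - z i) = 1" if i: "i \<in> A - {j}" for i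
      proof -
        have "z j \<noteq> z i" using i inj_on_eq_iff[OF assms(2), of j i] \<open>j \<in> A\<close> by blast
        then show ?thesis unfolding True[symmetric] by (intro divide_self) simp
      qed
      then have "(\<Prod>i\<in>A - {j}. (z m - z i) / (z j - z i)) = 1" by (intro prod.neutral ballI)
      then show ?thesis using True by simp
    next
      case False
      then show ?thesis using assms(1) \<open>m \<in> A\<close> by (auto intro!: prod_zero)
    qed
    then have "poly L (z m) = (\<Sum>j\<in>A. if j = m then poly q (z j) else 0)"
      unfolding L by (intro sum.cong) auto
    then show ?thesis using assms(1) that by simp
  qed
  have deg: "degree L < card A"
  proof -
    have "degree (smult (poly q (z j)) (\<Prod>i\<in>A - {j}. smult (1 / (z j - z i)) [:- z i, 1:])) \<le> card A - 1"
      if "j \<in> A" for j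
    proof -
      have "degree (\<Prod>i\<in>A - {j}. smult (1 / (z j - z i)) [:- z i, 1:])
          \<le> (\<Sum>i\<in>A - {j}. degree (smult (1 / (z j - z i)) [:- z i, 1:]))"
        using degree_prod_sum_le[of "A - {j}" "\<lambda>i. smult (1 / (z j - z i)) [:- z i, 1:]"] assms(1)
        by (simp add: o_def)
      also have "\<dots> \<le> (\<Sum>i\<in>A - {j}. 1)" by (intro sum_mono) auto
      also have "\<dots> = card A - 1" using that assms(1) by simp
      finally show ?thesis by (meson degree_smult_le order_trans)
    qed
    then have "degree L \<le> card A - 1" unfolding L_def by (intro degree_sum_le assms(1))
    then show ?thesis using assms(3) by linarith
  qed
  have "L = q"
  proof (rule poly_eqI_degree)
    show "poly L y = poly q y" if "y \<in> z ` A" for y using that agree by blast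
    show "degree L < card (z ` A)" "degree q < card (z ` A)"
      unfolding card_image[OF assms(2)] by (fact deg, fact assms(3))
  qed
  then show ?thesis using L[of x] by (simp only:)
qed

subsection \<open>Long arcs\<close>

text \<open>For \<open>j < k\<close> the angle stays below \<open>pi / 2\<close> because
  \<open>2 * j < 2 * k - 1\<close>.\<close>

lemma cos_node_pos:
  assumes "j < k"
  shows "cos (real j * pi / real (2 * k - 1)) > 0"
proof (rule cos_gt_zero_pi)
  define N where "N = real (2 * k - 1)"
  have N: "N > 0" "2 * real j < N" using assms by (auto simp: N_def)
  show "- (pi / 2) < real j * pi / real (2 * k - 1)"
    by (rule less_le_trans[of _ 0]) auto
  show "real j * pi / real (2 * k - 1) < pi / 2"
    unfolding N_def[symmetric] pos_divide_less_eq[OF N(1)]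
    using mult_strict_right_mono[OF N(2) pi_gt_zero] by (simp add: mult_ac)
qed

lemma cos_node_less:
  assumes "i < j" "j < k"
  shows "cos (real j * pi / real (2 * k - 1)) < cos (real i * pi / real (2 * k - 1))"
proof (rule cos_monotone_0_pi)
  have N: "real (2 * k - 1) > 0" "real j \<le> real (2 * k - 1)" using assms by linarith+
  show "real i * pi / real (2 * k - 1) < real j * pi / real (2 * k - 1)"
    using N assms by (intro divide_strict_right_mono mult_strict_right_mono) auto
  show "real j * pi / real (2 * k - 1) \<le> pi"
    unfolding pos_divide_le_eq[OF N(1)] using mult_right_mono[OF N(2), of pi] by (simp add: mult.commute)
  show "0 \<le> real i * pi / real (2 * k - 1)" by simp
qed

lemma cos_node_square_less:
  assumes "i < j" "j < k"
  shows "(cos (real j * pi / real (2 * k - 1)))\<^sup>2 < (cos (real i * pi / real (2 * k - 1)))\<^sup>2"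
  using cos_node_less[OF assms] cos_node_pos[of j k] assms by (intro power_strict_mono) auto

text \<open>
  The nodes \<open>y j\<close> are the positive extremal points of the Chebyshev polynomial of degree \<open>2 k - 1\<close>.
  For \<open>cos t\<close> below all nodes the Lagrange weights alternate in sign exactly as the values of
  that polynomial at the nodes do, so the sum of their absolute values is \<open>\<bar>cos ((2 k - 1) t)\<bar>\<close>.
\<close>

lemma signed_weights:
  fixes k :: nat and t :: real
  assumes k: "k \<ge> 1" and x0: "0 \<le> cos t" "cos t < cos (real (k - 1) * pi / real (2 * k - 1))"
  defines "y \<equiv> \<lambda>j. cos (real j * pi / real (2 * k - 1))"
  defines "w \<equiv> \<lambda>j. cos t / y j * (\<Prod>i\<in>{..<k} - {j}. ((cos t)\<^sup>2 - (y i)\<^sup>2) / ((y j)\<^sup>2 - (y i)\<^sup>2))"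
  shows "p < k \<Longrightarrow> (\<Sum>j<k. w j * cos (real (2 * p + 1) * (real j * pi / real (2 * k - 1)))) =
            cos (real (2 * p + 1) * t)"
    and "(\<Sum>j<k. \<bar>w j\<bar>) \<le> 1"
    and "cos t > 0 \<Longrightarrow> j < k \<Longrightarrow> w j \<noteq> 0"
proof -
  have y: "cos (real j * pi / real (2 * k - 1)) = y j" for j by (simp add: y_def)
  have ypos: "y j > 0" if "j < k" for j using cos_node_pos[OF that] by (simp add: y_def)
  have yless: "(y j)\<^sup>2 < (y i)\<^sup>2" if "i < j" "j < k" for i j
    using cos_node_square_less[OF that] by (simp add: y_def)
  have tless: "(cos t)\<^sup>2 < (y j)\<^sup>2" if "j < k" for j
  proof -
    have "cos t < y (k - 1)" using x0 by (simp add: y_def)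
    also have "y (k - 1) \<le> y j"
      using cos_node_less[of j "k - 1" k] that k by (cases "j = k - 1") (auto simp: y_def less_le)
    finally show ?thesis using x0 by (intro power_strict_mono) auto
  qed
  have inj: "inj_on (\<lambda>j. (y j)\<^sup>2) {..<k}"
    by (rule linorder_inj_onI') (use yless in \<open>fastforce\<close>)
  show eq: "(\<Sum>j<k. w j * cos (real (2 * p + 1) * (real j * pi / real (2 * k - 1)))) =
            cos (real (2 * p + 1) * t)" if "p < k" for p
  proof -
    \<comment> \<open>The factor \<open>cos t / y j\<close> of the weight reduces the odd function
      to \<open>odd_cheb p\<close>, a polynomial of degree at most \<open>p < k\<close> in the
      squared cosine; the rest of the weight is the Lagrange factor for the squared nodes.\<close>
    have "(\<Sum>j<k. w j * cos (real (2 * p + 1) * (real j * pi / real (2 * k - 1)))) =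
      cos t * (\<Sum>j<k. poly (odd_cheb p) ((y j)\<^sup>2) *
        (\<Prod>i\<in>{..<k} - {j}. ((cos t)\<^sup>2 - (y i)\<^sup>2) / ((y j)\<^sup>2 - (y i)\<^sup>2)))"
      unfolding cos_odd_multiple y sum_distrib_left
    proof (intro sum.cong refl)
      fix j assume "j \<in> {..<k}"
      then show "w j * (y j * poly (odd_cheb p) ((y j)\<^sup>2)) = cos t * (poly (odd_cheb p) ((y j)\<^sup>2) *
        (\<Prod>i\<in>{..<k} - {j}. ((cos t)\<^sup>2 - (y i)\<^sup>2) / ((y j)\<^sup>2 - (y i)\<^sup>2)))"
        using ypos[of j] by (simp add: w_def)
    qed
    also have "\<dots> = cos t * poly (odd_cheb p) ((cos t)\<^sup>2)"
      using degree_odd_cheb[of p] that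
      by (simp add: lagrange_interpolation[OF _ inj, of "odd_cheb p" "(cos t)\<^sup>2", symmetric])
    also have "\<dots> = cos (real (2 * p + 1) * t)" by (rule cos_odd_multiple[symmetric])
    finally show ?thesis .
  qed
  show "w j \<noteq> 0" if "cos t > 0" "j < k" for j
  proof -
    have "((cos t)\<^sup>2 - (y i)\<^sup>2) / ((y j)\<^sup>2 - (y i)\<^sup>2) \<noteq> 0" if "i \<in> {..<k} - {j}" for i
      using tless[of i] inj_onD[OF inj, of i j] \<open>j < k\<close> that by auto
    then show ?thesis using that ypos[of j] by (simp add: w_def)
  qed
  \<comment> \<open>All numerators are negative, and the denominator is negative for
    \<open>i < j\<close> and positive for \<open>i > j\<close>. So exactly \<open>k - 1 - j\<close>
    factors are negative.\<close>
  have sgn: "\<bar>w j\<bar> = (-1) ^ (k - 1) * (w j * (-1) ^ j)" if "j < k" for j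
  proof -
    have "(-1) ^ (k - 1 + j) * (\<Prod>i\<in>{..<k} - {j}. ((cos t)\<^sup>2 - (y i)\<^sup>2) / ((y j)\<^sup>2 - (y i)\<^sup>2))
       = (\<Prod>i\<in>{..<k} - {j}. \<bar>((cos t)\<^sup>2 - (y i)\<^sup>2) / ((y j)\<^sup>2 - (y i)\<^sup>2)\<bar>)"
    proof -
      have "\<bar>((cos t)\<^sup>2 - (y i)\<^sup>2) / ((y j)\<^sup>2 - (y i)\<^sup>2)\<bar> =
         (if i \<in> {..<j} then 1 else -1) * (((cos t)\<^sup>2 - (y i)\<^sup>2) / ((y j)\<^sup>2 - (y i)\<^sup>2))"
        if i: "i \<in> {..<k} - {j}" for i
      proof (cases "i < j")
        case True
        then have "((cos t)\<^sup>2 - (y i)\<^sup>2) / ((y j)\<^sup>2 - (y i)\<^sup>2) > 0"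
          using tless[of i] yless[of i j] \<open>j < k\<close> by (intro divide_neg_neg) auto
        then show ?thesis using True by (simp only: abs_of_pos lessThan_iff if_True mult_1)
      next
        case False
        then have "((cos t)\<^sup>2 - (y i)\<^sup>2) / ((y j)\<^sup>2 - (y i)\<^sup>2) < 0"
          using tless[of i] yless[of j i] i by (intro divide_neg_pos) auto
        then show ?thesis using False by (simp only: abs_of_neg lessThan_iff if_False mult_minus1)
      qed
      then have "(\<Prod>i\<in>{..<k} - {j}. \<bar>((cos t)\<^sup>2 - (y i)\<^sup>2) / ((y j)\<^sup>2 - (y i)\<^sup>2)\<bar>) =
         (\<Prod>i\<in>{..<k} - {j}. if i \<in> {..<j} then 1 else -1) *
         (\<Prod>i\<in>{..<k} - {j}. ((cos t)\<^sup>2 - (y i)\<^sup>2) / ((y j)\<^sup>2 - (y i)\<^sup>2))"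
        by (simp only: prod.distrib[symmetric] cong: prod.cong)
      also have "(\<Prod>i\<in>{..<k} - {j}. if i \<in> {..<j} then 1 else (-1::real)) = (-1) ^ (k - 1 + j)"
      proof -
        have split: "{..<k} - {j} = {..<j} \<union> {j<..<k}" using that by auto
        have "(\<Prod>i\<in>{..<k} - {j}. if i \<in> {..<j} then 1 else (-1::real)) =
            (\<Prod>i<j. if i \<in> {..<j} then 1 else -1) * (\<Prod>i\<in>{j<..<k}. if i \<in> {..<j} then 1 else -1)"
          unfolding split by (rule prod.union_disjoint) auto
        also have "\<dots> = (\<Prod>i<j. 1) * (\<Prod>i\<in>{j<..<k}. -1)"
          by (intro arg_cong2[where f = "(*)"] prod.cong) auto
        also have "\<dots> = (-1) ^ (k - 1 - j)" by simp
        \<comment> \<open>An even power removes the subtraction of \<open>j\<close>, so that the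
          sign splits into \<open>(-1) ^ (k - 1)\<close> and \<open>(-1) ^ j\<close>.\<close>
        also have "\<dots> = (-1) ^ (k - 1 - j) * (-1) ^ (2 * j)" by simp
        also have "\<dots> = (-1) ^ (k - 1 + j)"
          using that by (simp only: power_add[symmetric]) (simp add: algebra_simps)
        finally show ?thesis .
      qed
      finally show ?thesis by simp
    qed
    then have "(-1) ^ (k - 1 + j) * w j = cos t / y j *
        (\<Prod>i\<in>{..<k} - {j}. \<bar>((cos t)\<^sup>2 - (y i)\<^sup>2) / ((y j)\<^sup>2 - (y i)\<^sup>2)\<bar>)"
      by (simp add: w_def mult.left_commute)
    also have "\<dots> = \<bar>w j\<bar>"
      using ypos[OF that] x0(1) by (simp add: w_def abs_mult abs_prod)
    finally show ?thesis by (simp add: power_add mult_ac)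
  qed
  have "(\<Sum>j<k. \<bar>w j\<bar>) = (-1) ^ (k - 1) * (\<Sum>j<k. w j * (-1) ^ j)"
    by (simp add: sgn sum_distrib_left)
  \<comment> \<open>At the top frequency, \<open>p = k - 1\<close>, node \<open>j\<close> has cosine
    \<open>cos (j * pi) = (-1) ^ j\<close>, so the alternating sum is an instance of the
    interpolation identity \<open>eq\<close>.\<close>
  also have "(\<Sum>j<k. w j * (-1) ^ j) =
      (\<Sum>j<k. w j * cos (real (2 * (k - 1) + 1) * (real j * pi / real (2 * k - 1))))"
  proof (intro sum.cong refl)
    fix j
    have "2 * (k - 1) + 1 = 2 * k - 1" using k by simp
    then have "real (2 * (k - 1) + 1) * (real j * pi / real (2 * k - 1)) = real j * pi"
      using k by simp
    then show "w j * (-1) ^ j = w j * cos (real (2 * (k - 1) + 1) * (real j * pi / real (2 * k - 1)))"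
      by (simp only: cos_npi)
  qed
  also have "\<dots> = cos (real (2 * (k - 1) + 1) * t)" using k by (intro eq) auto
  finally have "(\<Sum>j<k. \<bar>w j\<bar>) = (-1) ^ (k - 1) * cos (real (2 * (k - 1) + 1) * t)" .
  also have "\<dots> \<le> \<bar>(-1) ^ (k - 1) * cos (real (2 * (k - 1) + 1) * t)\<bar>" by (rule abs_ge_self)
  also have "\<dots> \<le> 1" by (simp add: abs_mult del: of_nat_mult of_nat_add)
  finally show "(\<Sum>j<k. \<bar>w j\<bar>) \<le> 1" .
qed

definition SM_mid :: "nat \<Rightarrow> real \<Rightarrow> real \<Rightarrow> real ^ 'n::{finite,linorder}" where
  "SM_mid k c \<phi> = (1 / 2) *\<^sub>R (SM k (c + \<phi>) + SM k (c - \<phi>))"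

lemma sum_SM_mid:
  assumes "CARD('n::{finite,linorder}) = 2 * k"
    and "\<And>p. p < k \<Longrightarrow> (\<Sum>i\<in>I. w i * cos (real (2 * p + 1) * \<phi> i)) = cos (real (2 * p + 1) * t)"
  shows "(\<Sum>i\<in>I. w i *\<^sub>R SM_mid k c (\<phi> i)) = (SM_mid k c t :: real ^ 'n::{finite,linorder})"
proof -
  have "(\<Sum>i\<in>I. w i *\<^sub>R SM_mid k c (\<phi> i)) =
      ((1 / 2) *\<^sub>R (\<Sum>i\<in>I. w i *\<^sub>R (SM k (c + \<phi> i) + SM k (c - \<phi> i))) :: real ^ 'n::{finite,linorder})"
    unfolding SM_mid_def scaleR_sum_right by (simp only: scaleR_scaleR mult.commute)
  also have "\<dots> = SM_mid k c t"
    unfolding SM_mid_def by (simp only: sum_SM_add_SM_diff[OF assms])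
  finally show ?thesis .
qed

text \<open>A face containing the midpoint of two points of the orbitope contains both, so
  \<open>SM k (c + \<phi>)\<close> lies on the segment and must be one of its ends. Cancelling
  \<open>cis c\<close> leaves \<phi> equal to \<open>t\<close> or \<open>- t\<close> up to full
  turns.\<close>

lemma SM_mid_in_face:
  assumes "CARD('n::{finite,linorder}) = 2 * k" "k \<ge> 1"
    and face: "closed_segment (SM k (c - t)) (SM k (c + t)) face_of (orbitope k :: (real ^ 'n::{finite,linorder}) set)"
    and mem: "(SM_mid k c \<phi> :: real ^ 'n::{finite,linorder}) \<in> closed_segment (SM k (c - t)) (SM k (c + t))"
  shows "cos \<phi> = cos t"
proof -
  let ?F = "closed_segment (SM k (c - t)) (SM k (c + t)) :: (real ^ 'n::{finite,linorder}) set"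
  have "(SM k (c + \<phi>) :: real ^ 'n::{finite,linorder}) \<in> ?F"
  proof (cases "(SM k (c + \<phi>) :: real ^ 'n::{finite,linorder}) = SM k (c - \<phi>)")
    case True
    then have "SM_mid k c \<phi> = (SM k (c + \<phi>) :: real ^ 'n::{finite,linorder})"
      by (simp add: SM_mid_def scaleR_2[symmetric])
    with mem show ?thesis by simp
  next
    case False
    have "SM_mid k c \<phi> = midpoint (SM k (c + \<phi>)) (SM k (c - \<phi>) :: real ^ 'n::{finite,linorder})"
      by (simp add: SM_mid_def midpoint_def)
    with False have "(SM_mid k c \<phi> :: real ^ 'n::{finite,linorder}) \<in> open_segment (SM k (c + \<phi>)) (SM k (c - \<phi>))"
      by simp
    from face_ofD[OF face this SM_in_orbitope SM_in_orbitope mem] show ?thesis by blast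
  qed
  then have "cis (c + \<phi>) = cis (c - t) \<or> cis (c + \<phi>) = cis (c + t)"
    by (rule SM_in_segment[OF assms(1,2)])
  then have "cis \<phi> = cis (- t) \<or> cis \<phi> = cis t"
    using cis_mult[of c] by (metis add.commute diff_conv_add_uminus cis_neq_zero mult_cancel_left)
  then show ?thesis by (auto simp: complex_eq_iff)
qed

text \<open>The contradiction comes from the node of index 0 alone: its weight is positive and its
  angle is 0 or \<open>pi\<close>, so \<open>cos t\<close> would be 1 or -1, whereas
  \<open>0 \<le> cos t < 1\<close>.\<close>

lemma not_face_of_orbitope:
  fixes c :: real
  assumes card: "CARD('n::{finite,linorder}) = 2 * k" and k: "k \<ge> 1"
    and t: "0 \<le> cos t" "cos t < cos (real (k - 1) * pi / real (2 * k - 1))"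
  shows "\<not> closed_segment (SM k (c - t)) (SM k (c + t)) face_of (orbitope k :: (real ^ 'n::{finite,linorder}) set)"
proof
  let ?F = "closed_segment (SM k (c - t)) (SM k (c + t)) :: (real ^ 'n::{finite,linorder}) set"
  assume face: "?F face_of orbitope k"
  have conv: "convex (orbitope k :: (real ^ 'n::{finite,linorder}) set)" by (simp add: orbitope_def)
  have mid: "(SM_mid k c \<phi> :: real ^ 'n::{finite,linorder}) \<in> orbitope k" for \<phi>
    using convexD[OF conv SM_in_orbitope[of k "c + \<phi>"] SM_in_orbitope[of k "c - \<phi>"], of "1/2" "1/2"]
    by (simp add: SM_mid_def scaleR_right_distrib)
  have mid_t: "(SM_mid k c t :: real ^ 'n::{finite,linorder}) \<in> ?F"
    unfolding in_segment SM_mid_def by (intro exI[of _ "1 / 2"]) (simp add: scaleR_right_distrib add.commute)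
  \<comment> \<open>Reproducing the odd cosines at \<open>t\<close> with nonnegative weights of sum
    1 exhibits the midpoint of the segment as a convex combination, so every node of positive weight
    yields a midpoint in the face.\<close>
  have contact: "cos (\<phi> j) = cos t"
    if "finite I" "\<And>i. i \<in> I \<Longrightarrow> w i \<ge> 0" "sum w I = 1" "j \<in> I" "w j > 0"
      "\<And>p. p < k \<Longrightarrow> (\<Sum>i\<in>I. w i * cos (real (2 * p + 1) * \<phi> i)) = cos (real (2 * p + 1) * t)"
    for I :: "nat set" and w \<phi> j
  proof -
    have "(SM_mid k c (\<phi> j) :: real ^ 'n::{finite,linorder}) \<in> ?F"
    proof (rule face_of_convex_combination[OF face that(1) mid that(2) conv that(3) _ that(4,5)])
      show "(\<Sum>i\<in>I. w i *\<^sub>R (SM_mid k c (\<phi> i) :: real ^ 'n::{finite,linorder})) \<in> ?F"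
        using sum_SM_mid[OF card that(6), where c = c] mid_t by simp
    qed
    then show ?thesis by (rule SM_mid_in_face[OF card k face])
  qed
  have t1: "cos t < 1" using t(2) cos_le_one by (rule less_le_trans)
  have shift: "cos (real (2 * p + 1) * (x + pi)) = - cos (real (2 * p + 1) * x)" for p x
    unfolding distrib_left cos_add cos_npi sin_npi by simp
  show False
  proof (cases "cos t = 0")
    case True
    \<comment> \<open>Here every interpolation weight has the factor \<open>cos t = 0\<close>.
      Instead, the opposite angles 0 and \<open>pi\<close> with weight 1/2 each produce the value 0
      at all odd frequencies.\<close>
    have "cos (real (2 * p + 1) * t) = 0" for p
      unfolding cos_odd_multiple True by simp
    then have "cos (if (0::nat) = 0 then 0 else pi) = cos t"
      using shift[of _ 0] by (intro contact[of "{0, 1}" "\<lambda>_. 1 / 2" 0 "\<lambda>i. if i = 0 then 0 else pi"]) auto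
    with True show False by simp
  next
    case False
    with t have tpos: "cos t > 0" by simp
    define \<theta> where "\<theta> j = real j * pi / real (2 * k - 1)" for j
    define w where "w j = cos t / cos (\<theta> j) *
      (\<Prod>i\<in>{..<k} - {j}. ((cos t)\<^sup>2 - (cos (\<theta> i))\<^sup>2) / ((cos (\<theta> j))\<^sup>2 - (cos (\<theta> i))\<^sup>2))" for j
    note weights = signed_weights[OF k t, folded \<theta>_def, folded w_def]
    \<comment> \<open>The term with index \<open>k\<close> has node \<open>pi / 2\<close>, where all odd cosines vanish: it only fills up the total
      weight to 1. A negative weight is made positive by shifting its node by \<open>pi\<close>.\<close>
    define w' where "w' j = (if j < k then \<bar>w j\<bar> else 1 - (\<Sum>i<k. \<bar>w i\<bar>))" for j
    define \<phi> where "\<phi> j = (if j < k then if w j \<ge> 0 then \<theta> j else \<theta> j + pi else pi / 2)" for j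
    have "cos (\<phi> 0) = cos t"
    proof (rule contact[of "{..k}" w'])
      show "w' i \<ge> 0" for i using weights(2) by (simp add: w'_def)
      show "sum w' {..k} = 1"
        by (simp add: lessThan_Suc_atMost[symmetric] w'_def)
      show "w' 0 > 0" using weights(3)[OF tpos, of 0] k by (simp add: w'_def)
      fix p assume "p < k"
      have "cos (real (2 * p + 1) * (pi / 2)) = 0"
        unfolding cos_odd_multiple by simp
      then have "(\<Sum>i\<le>k. w' i * cos (real (2 * p + 1) * \<phi> i)) = (\<Sum>i<k. w' i * cos (real (2 * p + 1) * \<phi> i))"
        by (simp add: lessThan_Suc_atMost[symmetric] \<phi>_def del: of_nat_mult of_nat_add)
      also have "\<dots> = (\<Sum>i<k. w i * cos (real (2 * p + 1) * \<theta> i))"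
      proof (intro sum.cong refl)
        fix i assume "i \<in> {..<k}"
        then have i: "i < k" by simp
        have "cos (real (2 * p + 1) * \<phi> i) = (if w i \<ge> 0 then 1 else -1) * cos (real (2 * p + 1) * \<theta> i)"
          by (cases "w i \<ge> 0") (simp_all only: \<phi>_def i if_True if_False shift mult_1 mult_minus1)
        moreover have "w' i * (if w i \<ge> 0 then 1 else -1) = w i" using i by (simp add: w'_def)
        ultimately show "w' i * cos (real (2 * p + 1) * \<phi> i) = w i * cos (real (2 * p + 1) * \<theta> i)"
          by (metis mult.assoc)
      qed
      also have "\<dots> = cos (real (2 * p + 1) * t)" by (rule weights(1)[OF \<open>p < k\<close>])
      finally show "(\<Sum>i\<le>k. w' i * cos (real (2 * p + 1) * \<phi> i)) = cos (real (2 * p + 1) * t)" .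
    qed auto
    then show False using k tpos t1 by (auto simp: \<phi>_def \<theta>_def split: if_splits)
  qed
qed

subsection \<open>Short arcs\<close>

text \<open>Since the curve is compact, a face of its hull is the hull of a part of the curve. The
  supporting hyperplane meets the curve only at the zeros of
  \<open>C + a \<bullet> SM k \<theta>\<close>, which leaves the two endpoints.\<close>

lemma exposed_edge_of_orbitope:
  fixes a :: "real ^ 'n::{finite,linorder}"
  assumes card: "CARD('n::{finite,linorder}) = 2 * k" and k: "k \<ge> 1"
    and neq: "cis \<alpha> \<noteq> cis \<beta>"
    and nonneg: "\<And>\<theta>. C + a \<bullet> SM k \<theta> \<ge> 0"
    and zero: "\<And>\<theta>. C + a \<bullet> SM k \<theta> = 0 \<longleftrightarrow> cis \<theta> = cis \<alpha> \<or> cis \<theta> = cis \<beta>"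
  shows "closed_segment (SM k \<alpha>) (SM k \<beta>) exposed_edge_of (orbitope k :: (real ^ 'n::{finite,linorder}) set)"
proof -
  let ?S = "orbitope k :: (real ^ 'n::{finite,linorder}) set" and ?T = "orbitope k \<inter> {x. (- a) \<bullet> x = C}"
  let ?E = "closed_segment (SM k \<alpha>) (SM k \<beta>) :: (real ^ 'n::{finite,linorder}) set"
  have S: "?S = convex hull range (SM k)" by (simp add: orbitope_def range_SM)
  have "continuous_on {0..2 * pi} (SM k :: real \<Rightarrow> real ^ 'n::{finite,linorder})"
    unfolding SM_coeff_vec coeff_vec_def
  proof (rule continuous_on_vec_lambda)
    fix i :: 'n
    show "continuous_on {0..2 * pi} (\<lambda>\<theta>. if coord_pos i < k then cos (real (2 * coord_pos i + 1) * \<theta>)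
        else sin (real (2 * (coord_pos i - k) + 1) * \<theta>))"
      by (cases "coord_pos i < k") (simp_all only: if_True if_False, (intro continuous_intros)+)
  qed
  then have "compact (range (SM k) :: (real ^ 'n::{finite,linorder}) set)"
    unfolding range_SM by (intro compact_continuous_image compact_Icc)
  have "(- a) \<bullet> SM k \<theta> \<le> C" for \<theta> using nonneg[of \<theta>] by simp
  then have "range (SM k) \<subseteq> {x. (- a) \<bullet> x \<le> C}" by blast
  then have sub: "?S \<subseteq> {x. (- a) \<bullet> x \<le> C}"
    unfolding S by (intro hull_minimal convex_halfspace_le)
  then have face: "?T face_of ?S"
    by (intro face_of_Int_supporting_hyperplane_le) (auto simp: S)
  then obtain S' where S': "S' \<subseteq> range (SM k)" "?T = convex hull S'"
    using face_of_convex_hull_subset[OF \<open>compact (range (SM k))\<close>, of ?T] unfolding S by blast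
  have zero': "(- a) \<bullet> SM k \<theta> = C \<longleftrightarrow> cis \<theta> = cis \<alpha> \<or> cis \<theta> = cis \<beta>" for \<theta>
    using zero[of \<theta>] by auto
  have "S' \<subseteq> {SM k \<alpha>, SM k \<beta>}"
  proof
    fix x assume "x \<in> S'"
    then obtain \<theta> where \<theta>: "x = SM k \<theta>" using S' by blast
    have "x \<in> ?T" using \<open>x \<in> S'\<close> S'(2) hull_inc by metis
    then have "cis \<theta> = cis \<alpha> \<or> cis \<theta> = cis \<beta>" using zero'[of \<theta>] \<theta> by simp
    then show "x \<in> {SM k \<alpha>, SM k \<beta>}" using SM_cong_cis \<theta> by blast
  qed
  then have "?T \<subseteq> ?E" unfolding S'(2) segment_convex_hull by (rule hull_mono)
  moreover have "?E \<subseteq> ?T"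
    unfolding segment_convex_hull
  proof (rule hull_minimal)
    show "{SM k \<alpha>, SM k \<beta>} \<subseteq> ?T" using zero' by (simp add: SM_in_orbitope)
    show "convex ?T" using face by (rule face_of_imp_convex)
  qed
  ultimately have E: "?E = ?T" by blast
  \<comment> \<open>Otherwise the function is constant, and zero because it vanishes at \<alpha>.
    Then every angle is a zero, but 0, \<open>pi / 2\<close> and \<open>pi\<close> give three
    different points of the circle.\<close>
  have "a \<noteq> 0"
  proof
    assume "a = 0"
    then have "cis \<theta> = cis \<alpha> \<or> cis \<theta> = cis \<beta>" for \<theta> using zero[of \<theta>] zero[of \<alpha>] by auto
    from this[of 0] this[of "pi / 2"] this[of pi] show False
      by (auto simp: complex_eq_iff)
  qed
  moreover have "aff_dim ?E = 1"
    unfolding segment_convex_hull aff_dim_convex_hull using neq SM_eq_iff[OF card k] by simp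
  ultimately show ?thesis
    unfolding exposed_edge_of_def edge_of_def using face sub E
    by (intro conjI exI[of _ "- a"] exI[of _ C]) auto
qed

text \<open>After expansion into odd cosines of \<open>\<theta> - c\<close>, the addition formula
  separates \<theta> from \<open>c\<close>, and the coordinates of \<open>a\<close> can be read
  off.\<close>

lemma odd_poly_as_inner_SM:
  fixes R :: "real poly"
  assumes "CARD('n::{finite,linorder}) = 2 * k" "degree R < k"
  obtains a :: "real ^ 'n::{finite,linorder}"
    where "\<And>\<theta>. a \<bullet> SM k \<theta> = cos (\<theta> - c) * poly R ((cos (\<theta> - c))\<^sup>2)"
proof -
  have "degree R \<le> k - 1" using assms(2) by simp
  then obtain b where b: "\<And>x. cos x * poly R ((cos x)\<^sup>2) = (\<Sum>i\<le>k - 1. b i * cos (real (2 * i + 1) * x))"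
    using odd_poly_cos_expansion by meson
  have "{..k - 1} = {..<k}" using assms(2) by auto
  have "coeff_vec k (\<lambda>p. b p * cos (real (2 * p + 1) * c)) (\<lambda>p. b p * sin (real (2 * p + 1) * c))
      \<bullet> (SM k \<theta> :: real ^ 'n::{finite,linorder}) = cos (\<theta> - c) * poly R ((cos (\<theta> - c))\<^sup>2)" for \<theta>
    unfolding SM_coeff_vec inner_coeff_vec[OF assms(1)] b \<open>{..k - 1} = {..<k}\<close>
  proof (intro sum.cong refl)
    fix p
    have "b p * cos (m * c) * cos (m * \<theta>) + b p * sin (m * c) * sin (m * \<theta>) = b p * cos (m * (\<theta> - c))" for m
      by (simp add: right_diff_distrib cos_diff algebra_simps)
    then show "b p * cos (real (2 * p + 1) * c) * cos (real (2 * p + 1) * \<theta>) +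
        b p * sin (real (2 * p + 1) * c) * sin (real (2 * p + 1) * \<theta>) = b p * cos (real (2 * p + 1) * (\<theta> - c))" .
  qed
  then show ?thesis by (rule that)
qed

text \<open>The maximum of \<open>f\<close> and \<open>g\<close> is positive on \<open>S\<close>,
  hence by compactness at least some \<open>m > 0\<close>. Where \<open>g \<le> 0\<close>, this
  bounds \<open>f\<close> from below, and with \<open>\<bar>g\<bar> \<le> M\<close> the factor
  \<open>m / (2 * M)\<close> uses up at most half of it.\<close>

lemma small_perturbation_pos:
  fixes f g :: "'a::topological_space \<Rightarrow> real"
  assumes "compact S" "continuous_on S f" "continuous_on S g"
    and nonneg: "\<And>x. x \<in> S \<Longrightarrow> f x \<ge> 0" and pos: "\<And>x. x \<in> S \<Longrightarrow> f x = 0 \<Longrightarrow> g x > 0"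
  obtains e where "e > 0" "\<And>x. x \<in> S \<Longrightarrow> f x + e * g x > 0"
proof (cases "S = {}")
  case True
  then show ?thesis using that[of 1] by simp
next
  case False
  have "continuous_on S (\<lambda>x. max (f x) (g x))" using assms by (intro continuous_intros)
  then obtain x0 where x0: "x0 \<in> S" "\<And>x. x \<in> S \<Longrightarrow> max (f x0) (g x0) \<le> max (f x) (g x)"
    using continuous_attains_inf[OF assms(1) False] by blast
  define m where "m = max (f x0) (g x0)"
  have m: "m > 0" using nonneg[OF x0(1)] pos[OF x0(1)]
    by (cases "f x0 = 0") (auto simp: m_def less_max_iff_disj)
  obtain M where M: "M > 0" "\<And>x. x \<in> S \<Longrightarrow> \<bar>g x\<bar> \<le> M"
    using compact_imp_bounded[OF compact_continuous_image[OF assms(3,1)]] by (auto simp: bounded_pos)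
  show ?thesis
  proof (rule that[of "m / (2 * M)"])
    show "m / (2 * M) > 0" using m M by simp
    fix x assume x: "x \<in> S"
    show "f x + m / (2 * M) * g x > 0"
    proof (cases "g x > 0")
      case True
      then have "m / (2 * M) * g x > 0" using m M(1) by simp
      then show ?thesis using nonneg[OF x] by linarith
    next
      case False
      then have "f x \<ge> m" using x0(2)[OF x] m by (simp add: m_def max_def split: if_splits)
      moreover have "m / (2 * M) * g x \<ge> m / (2 * M) * (- M)"
        using m M(1) M(2)[OF x] by (intro mult_left_mono) auto
      moreover have "m / (2 * M) * (- M) = - m / 2" using M by simp
      ultimately show ?thesis using m by linarith
    qed
  qed
qed

section \<open>Polynomials with a prescribed double zero\<close>

text \<open>The linear factor splits off twice, since the derivative of
  \<open>[:- x, 1:] * q\<close> at \<open>x\<close> is \<open>poly q x\<close>. The second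
  conclusion lets the sign of the second derivative be read as the sign of the cofactor
  \<open>h\<close> at \<open>x\<close>.\<close>

lemma double_root_factor:
  fixes p :: "'a::field poly"
  assumes "poly p x = 0" "poly (pderiv p) x = 0"
  obtains h where "p = [:- x, 1:]\<^sup>2 * h" "poly (pderiv (pderiv p)) x = 2 * poly h x"
proof -
  have d1: "poly (pderiv ([:- x, 1:] * q)) x = poly q x" for q
    unfolding pderiv_mult by (simp add: pderiv_pCons)
  have d2: "poly (pderiv (pderiv ([:- x, 1:] * q))) x = 2 * poly (pderiv q) x" for q
    unfolding pderiv_mult pderiv_add by (simp add: pderiv_pCons)
  obtain q where q: "p = [:- x, 1:] * q" using assms(1) unfolding poly_eq_0_iff_dvd by (rule dvdE)
  have "poly q x = 0" using assms(2) unfolding q d1 .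
  then obtain h where h: "q = [:- x, 1:] * h" unfolding poly_eq_0_iff_dvd by (rule dvdE)
  show ?thesis
  proof (rule that)
    show "p = [:- x, 1:]\<^sup>2 * h" by (simp only: q h power2_eq_square mult.assoc)
    show "poly (pderiv (pderiv p)) x = 2 * poly h x" unfolding q d2 h d1 ..
  qed
qed

text \<open>Encodes odd polynomials by a polynomial in the square: degree below \<open>k\<close> for
  \<open>R\<close> means degree at most \<open>2 * k - 1\<close> here, the highest frequency of the
  curve.\<close>

definition odd_poly :: "real poly \<Rightarrow> real poly" where
  "odd_poly R = [:0, 1:] * pcompose R [:0, 0, 1:]"

lemma poly_odd_poly: "poly (odd_poly R) x = x * poly R (x\<^sup>2)"
  by (simp add: odd_poly_def poly_pcompose power2_eq_square)

lemma poly_pderiv_odd_poly: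
  "poly (pderiv (odd_poly R)) x = poly R (x\<^sup>2) + 2 * x\<^sup>2 * poly (pderiv R) (x\<^sup>2)"
  by (simp add: odd_poly_def pderiv_mult pderiv_pCons pderiv_pcompose poly_pcompose power2_eq_square
      algebra_simps)

text \<open>
  Adding a small multiple of \<open>1 + odd_poly Q\<close> to a nonnegative polynomial with a double zero at
  \<open>x0\<close> keeps that zero and removes all zeros whose squares are among the \<open>z j\<close>.
\<close>

lemma correction_poly:
  fixes A :: "nat set" and z :: "nat \<Rightarrow> real" and x0 :: real
  assumes "finite A" "x0 \<noteq> 0" "\<And>j. j \<in> A \<Longrightarrow> z j \<noteq> x0\<^sup>2"
  obtains Q where "degree Q \<le> card A + 1" "poly (odd_poly Q) x0 = -1" "poly (pderiv (odd_poly Q)) x0 = 0"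
    "\<And>j x. j \<in> A \<Longrightarrow> x\<^sup>2 = z j \<Longrightarrow> poly (odd_poly Q) x = 0"
proof -
  \<comment> \<open>\<open>Q\<close> inherits the zeros \<open>z j\<close> from \<open>r\<close>.
    Its linear factor is \<open>u + v * (X - x0^2)\<close>: the value -1 at \<open>x0\<close>
    determines \<open>u\<close>, and the vanishing derivative there determines
    \<open>v\<close>.\<close>
  define r where "r = (\<Prod>j\<in>A. [:- z j, 1:])"
  define u where "u = - 1 / (x0 * poly r (x0\<^sup>2))"
  define v where "v = - (poly r (x0\<^sup>2) * u + 2 * x0\<^sup>2 * poly (pderiv r) (x0\<^sup>2) * u) / (2 * x0\<^sup>2 * poly r (x0\<^sup>2))"
  define Q where "Q = r * [:u - v * x0\<^sup>2, v:]"
  have r0: "poly r (x0\<^sup>2) \<noteq> 0"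
    using assms(1) by (auto simp: r_def poly_prod) (metis assms(3))
  have Q_eval: "poly Q (x0\<^sup>2) = poly r (x0\<^sup>2) * u" by (simp add: Q_def algebra_simps)
  show ?thesis
  proof (rule that)
    have "degree r \<le> (\<Sum>j\<in>A. degree [:- z j, 1:])"
      using degree_prod_sum_le[OF assms(1), of "\<lambda>j. [:- z j, 1:]"] by (simp add: r_def o_def)
    then have "degree r \<le> card A" by simp
    moreover have "degree [:u - v * x0\<^sup>2, v:] \<le> 1" by simp
    ultimately show "degree Q \<le> card A + 1"
      unfolding Q_def using degree_mult_le[of r "[:u - v * x0\<^sup>2, v:]"] by linarith
    show "poly (odd_poly Q) x0 = -1"
      using r0 assms(2) by (simp add: poly_odd_poly Q_eval u_def)
    have "poly (pderiv Q) (x0\<^sup>2) = poly (pderiv r) (x0\<^sup>2) * u + poly r (x0\<^sup>2) * v"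
      unfolding Q_def pderiv_mult by (simp add: pderiv_pCons algebra_simps)
    then have "poly (pderiv (odd_poly Q)) x0 =
        poly r (x0\<^sup>2) * u + 2 * x0\<^sup>2 * poly (pderiv r) (x0\<^sup>2) * u + 2 * x0\<^sup>2 * poly r (x0\<^sup>2) * v"
      by (simp add: poly_pderiv_odd_poly Q_eval algebra_simps)
    also have "2 * x0\<^sup>2 * poly r (x0\<^sup>2) * v = - (poly r (x0\<^sup>2) * u + 2 * x0\<^sup>2 * poly (pderiv r) (x0\<^sup>2) * u)"
      using r0 assms(2) by (simp add: v_def)
    finally show "poly (pderiv (odd_poly Q)) x0 = 0" by simp
    fix j x assume "j \<in> A" "x\<^sup>2 = z j"
    then have "poly r (x\<^sup>2) = 0" using assms(1) by (auto simp: r_def poly_prod)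
    then show "poly (odd_poly Q) x = 0" by (simp add: poly_odd_poly Q_def)
  qed
qed

text \<open>
  Up to sign, \<open>odd_poly R\<close> is the Chebyshev polynomial of degree \<open>2 k - 1\<close> in the variable
  \<open>l * x\<close>, where \<open>l < 1\<close> moves its smallest positive extremal point to \<open>x0\<close>.
\<close>

lemma scaled_chebyshev:
  fixes k :: nat and x0 :: real
  assumes k: "k \<ge> 2" and x0: "cos (real (k - 1) * pi / real (2 * k - 1)) < x0"
  defines "y \<equiv> \<lambda>j. cos (real j * pi / real (2 * k - 1))"
  obtains R :: "real poly" where "degree R < k"
    "\<And>x. \<bar>x\<bar> \<le> 1 \<Longrightarrow> 1 + poly (odd_poly R) x \<ge> 0"
    "1 + poly (odd_poly R) x0 = 0" "poly (pderiv (odd_poly R)) x0 = 0"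
    "poly (pderiv (pderiv (odd_poly R))) x0 > 0"
    "\<And>x. \<bar>x\<bar> \<le> 1 \<Longrightarrow> 1 + poly (odd_poly R) x = 0 \<Longrightarrow> x \<noteq> x0 \<Longrightarrow>
       \<exists>j\<in>{1..<k - 1}. x\<^sup>2 = (x0 * y j / y (k - 1))\<^sup>2"
proof -
  define N where "N = real (2 * k - 1)"
  define \<phi>0 where "\<phi>0 = real (k - 1) * pi / N"
  define l where "l = cos \<phi>0 / x0"
  \<comment> \<open>Since \<open>cos (N * \<phi>0) = (-1) ^ (k - 1)\<close>, this sign makes the
    value at \<open>x0\<close> equal to -1.\<close>
  define s :: real where "s = (-1) ^ k"
  define R where "R = smult (s * l) (pcompose (odd_cheb (k - 1)) [:0, l\<^sup>2:])"
  have N: "N > 0" "real (2 * (k - 1) + 1) = N" using k by (auto simp: N_def)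
  have cos0: "cos \<phi>0 > 0" using cos_node_pos[of "k - 1" k] k by (simp add: \<phi>0_def N_def)
  have x0': "cos \<phi>0 < x0" using x0 by (simp add: \<phi>0_def N_def)
  have x0pos: "x0 > 0" using cos0 x0' by linarith
  have l: "0 < l" "l < 1" using cos0 x0' x0pos by (simp_all add: l_def)
  have lx0: "l * x0 = cos \<phi>0" using x0pos by (simp add: l_def)
  have s: "s * s = 1" "\<bar>s\<bar> = 1" by (simp_all add: s_def power_mult_distrib[symmetric])
  have N\<phi>0: "N * \<phi>0 = real (k - 1) * pi" using N by (simp add: \<phi>0_def)
  have s_cos: "s * cos (N * \<phi>0) = -1"
  proof -
    have "k = Suc (k - 1)" using k by simp
    then have "s = - ((-1) ^ (k - 1))" unfolding s_def by (metis power_Suc mult_minus1)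
    then show ?thesis unfolding N\<phi>0 cos_npi by (simp flip: power_mult_distrib)
  qed
  have R_cos: "poly (odd_poly R) x = s * cos (N * \<phi>)" if "l * x = cos \<phi>" for x \<phi>
  proof -
    have "poly (odd_poly R) x = s * ((l * x) * poly (odd_cheb (k - 1)) ((l * x)\<^sup>2))"
      by (simp add: poly_odd_poly R_def poly_pcompose power_mult_distrib mult_ac)
    then show ?thesis unfolding that cos_odd_multiple[symmetric] N(2) .
  qed
  have arccos_ex: "\<exists>\<phi>. 0 \<le> \<phi> \<and> \<phi> \<le> pi \<and> l * x = cos \<phi>" if "\<bar>x\<bar> \<le> 1" for x
  proof -
    have "\<bar>l * x\<bar> \<le> 1" using l that by (simp add: abs_mult mult_le_one)
    then show ?thesis by (intro exI[of _ "arccos (l * x)"]) (auto simp: arccos_bounded cos_arccos_abs)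
  qed
  have x0_root: "1 + poly (odd_poly R) x0 = 0" using R_cos[OF lx0] s_cos by simp
  have lx: "cos \<phi> / l = x \<longleftrightarrow> l * x = cos \<phi>" for x \<phi> using l by (auto simp: field_simps)
  have eq1: "(\<lambda>\<phi>. poly (odd_poly R) (cos \<phi> / l)) = (\<lambda>\<phi>. s * cos (N * \<phi>))"
    by (intro ext R_cos) (use l in simp)
  \<comment> \<open>Differentiating the identity \<open>eq1\<close> with respect to \<phi> yields
    the derivatives of the polynomial without a formula for its coefficients.\<close>
  have d1: "poly (pderiv (odd_poly R)) (cos \<phi> / l) * (- sin \<phi> / l) = - s * N * sin (N * \<phi>)" for \<phi>
  proof (rule DERIV_unique)
    show "((\<lambda>\<phi>. poly (odd_poly R) (cos \<phi> / l)) has_real_derivative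
        poly (pderiv (odd_poly R)) (cos \<phi> / l) * (- sin \<phi> / l)) (at \<phi>)"
      using l by (auto intro!: derivative_eq_intros DERIV_chain2[OF poly_DERIV])
    show "((\<lambda>\<phi>. poly (odd_poly R) (cos \<phi> / l)) has_real_derivative - s * N * sin (N * \<phi>)) (at \<phi>)"
      unfolding eq1 by (auto intro!: derivative_eq_intros)
  qed
  have sin0: "sin \<phi>0 > 0"
  proof (rule sin_gt_zero)
    show "0 < \<phi>0" using k N by (simp add: \<phi>0_def)
    have "real (k - 1) < N" using k by (simp add: N_def)
    then show "\<phi>0 < pi" using N by (simp add: \<phi>0_def field_simps)
  qed
  have x0l: "cos \<phi>0 / l = x0" using lx lx0 by simp
  have d1_x0: "poly (pderiv (odd_poly R)) x0 = 0"
    using d1[of \<phi>0] sin0 l unfolding x0l N\<phi>0 sin_npi by simp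
  have eq2: "(\<lambda>\<phi>. poly (pderiv (odd_poly R)) (cos \<phi> / l) * (- sin \<phi> / l)) = (\<lambda>\<phi>. - s * N * sin (N * \<phi>))"
    using d1 by blast
  \<comment> \<open>The product rule also gives a term with the first derivative at
    \<open>x0\<close>, which vanishes by \<open>d1_x0\<close>.\<close>
  have d2: "poly (pderiv (pderiv (odd_poly R))) x0 * (- sin \<phi>0 / l) * (- sin \<phi>0 / l) = N\<^sup>2"
  proof (rule DERIV_unique)
    have "((\<lambda>\<phi>. poly (pderiv (odd_poly R)) (cos \<phi> / l)) has_real_derivative
        poly (pderiv (pderiv (odd_poly R))) (cos \<phi>0 / l) * (- sin \<phi>0 / l)) (at \<phi>0)"
      using l by (auto intro!: derivative_eq_intros DERIV_chain2[OF poly_DERIV])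
    then show "((\<lambda>\<phi>. poly (pderiv (odd_poly R)) (cos \<phi> / l) * (- sin \<phi> / l)) has_real_derivative
        poly (pderiv (pderiv (odd_poly R))) x0 * (- sin \<phi>0 / l) * (- sin \<phi>0 / l)) (at \<phi>0)"
      using l by (auto intro!: derivative_eq_intros simp: x0l d1_x0)
    have "((\<lambda>\<phi>. - s * N * sin (N * \<phi>)) has_real_derivative - s * N * (cos (N * \<phi>0) * N)) (at \<phi>0)"
      by (auto intro!: derivative_eq_intros)
    also have "- s * N * (cos (N * \<phi>0) * N) = - (s * cos (N * \<phi>0)) * N\<^sup>2" by (simp add: power2_eq_square)
    also have "\<dots> = N\<^sup>2" unfolding s_cos by simp
    finally show "((\<lambda>\<phi>. poly (pderiv (odd_poly R)) (cos \<phi> / l) * (- sin \<phi> / l)) has_real_derivative N\<^sup>2) (at \<phi>0)"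
      unfolding eq2 .
  qed
  show ?thesis
  proof (rule that[of R])
    have "degree (pcompose (odd_cheb (k - 1)) [:0, l\<^sup>2:]) \<le> k - 1"
      using degree_pcompose_le[of "odd_cheb (k - 1)" "[:0, l\<^sup>2:]"] degree_odd_cheb[of "k - 1"] l by simp
    then show "degree R < k"
      unfolding R_def using degree_smult_le[of "s * l" "pcompose (odd_cheb (k - 1)) [:0, l\<^sup>2:]"] k by linarith
    show "1 + poly (odd_poly R) x \<ge> 0" if x: "\<bar>x\<bar> \<le> 1" for x
    proof -
      obtain \<phi> where "l * x = cos \<phi>" using arccos_ex[OF x] by blast
      then have "\<bar>poly (odd_poly R) x\<bar> \<le> 1" using s by (simp add: R_cos abs_mult)
      then show ?thesis by linarith
    qed
    show "1 + poly (odd_poly R) x0 = 0" "poly (pderiv (odd_poly R)) x0 = 0" by fact+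
    have "poly (pderiv (pderiv (odd_poly R))) x0 * (sin \<phi>0 / l)\<^sup>2 = N\<^sup>2"
      unfolding d2[symmetric] by (simp add: power2_eq_square)
    then have "poly (pderiv (pderiv (odd_poly R))) x0 * (sin \<phi>0 / l)\<^sup>2 > 0" using N by simp
    then show "poly (pderiv (pderiv (odd_poly R))) x0 > 0"
      by (simp add: zero_less_mult_iff)
    fix x assume x: "\<bar>x\<bar> \<le> 1" and root: "1 + poly (odd_poly R) x = 0" and neq: "x \<noteq> x0"
    obtain \<phi> where \<phi>: "0 \<le> \<phi>" "\<phi> \<le> pi" "l * x = cos \<phi>" using arccos_ex[OF x] by blast
    \<comment> \<open>At a zero, \<open>cos (N * \<phi>)\<close> is 1 or -1, so \<phi> is a multiple
      \<open>i * pi / N\<close>. The extreme indices 0 and \<open>N\<close> would mean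
      \<open>\<bar>l * x\<bar> = 1\<close>, which \<open>l < 1\<close> excludes.\<close>
    have "s * cos (N * \<phi>) = -1" using root R_cos[OF \<phi>(3)] by simp
    then have "(s * s) * (cos (N * \<phi>))\<^sup>2 = 1" by (metis mult.assoc mult.left_commute mult_minus1 minus_minus power2_eq_square)
    then have "sin (N * \<phi>) = 0" using s sin_cos_squared_add[of "N * \<phi>"] by simp
    then obtain i' :: int where "N * \<phi> = of_int i' * pi" using sin_zero_iff_int2 by blast
    moreover then have "i' \<ge> 0" using N \<phi>(1) by (metis mult_nonneg_nonneg less_eq_real_def of_int_0_le_iff pi_gt_zero zero_le_mult_iff not_less)
    ultimately obtain i where i: "N * \<phi> = real i * pi" by (metis nonneg_int_cases of_int_of_nat_eq)
    have \<phi>i: "\<phi> = real i * pi / N" using i N by (simp add: field_simps)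
    have "real i * pi \<le> N * pi" using i \<phi>(2) N by (metis mult_left_mono less_eq_real_def)
    then have "i \<le> 2 * k - 1" unfolding N_def by simp
    have small: "\<bar>cos \<phi>\<bar> < 1"
    proof -
      have "\<bar>l * x\<bar> \<le> l * 1" unfolding abs_mult using x l by (intro mult_mono) auto
      then show ?thesis using \<phi>(3) l by simp
    qed
    have "i \<noteq> 0" using small \<phi>i by (intro notI) simp
    have "i \<noteq> 2 * k - 1"
    proof
      assume "i = 2 * k - 1"
      then have "real i = N" by (simp add: N_def)
      then have "\<phi> = pi" using \<phi>i N(1) by simp
      then show False using small by simp
    qed
    \<comment> \<open>Replacing \<phi> by \<open>pi - \<phi>\<close> sends the index
      \<open>i\<close> to \<open>N - i\<close>, and one of the two is at most \<open>k - 1\<close>.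
      Only the sign of the cosine changes.\<close>
    obtain j where j: "j \<in> {1..k - 1}" "(cos \<phi>)\<^sup>2 = (y j)\<^sup>2"
    proof (cases "i \<le> k - 1")
      case True
      then show ?thesis using that[of i] \<open>i \<noteq> 0\<close> \<phi>i by (simp add: y_def N_def)
    next
      case False
      define j where "j = 2 * k - 1 - i"
      have "real j = N - real i" using \<open>i \<le> 2 * k - 1\<close> by (simp add: j_def N_def)
      then have "real j * pi / N = pi - \<phi>"
        using N(1) by (simp only: \<phi>i) (simp add: left_diff_distrib diff_divide_distrib)
      moreover have "y j = cos (real j * pi / N)" by (simp only: y_def N_def)
      ultimately have "y j = - cos \<phi>" by simp
      moreover have "j \<in> {1..k - 1}"
        using False \<open>i \<noteq> 2 * k - 1\<close> \<open>i \<le> 2 * k - 1\<close> unfolding j_def atLeastAtMost_iff by linarith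
      ultimately show ?thesis using that[of j] by simp
    qed
    have yk: "y (k - 1) = cos \<phi>0" by (simp add: y_def \<phi>0_def N_def)
    have x2: "x\<^sup>2 = (x0 * y j / y (k - 1))\<^sup>2"
    proof -
      have "x = cos \<phi> / l" using lx \<phi>(3) by metis
      then have "x\<^sup>2 = (y j)\<^sup>2 / l\<^sup>2" using j(2) by (simp add: power_divide)
      then show ?thesis unfolding yk l_def using x0pos cos0 by (simp add: power_divide power_mult_distrib)
    qed
    \<comment> \<open>The index \<open>k - 1\<close> would leave only \<open>x = - x0\<close>, where
      the odd polynomial has the value 1 instead of -1.\<close>
    have "j \<noteq> k - 1"
    proof
      assume "j = k - 1"
      then have "x\<^sup>2 = x0\<^sup>2" using x2 cos0 yk by simp
      then have "x = - x0" using neq by (auto simp: power2_eq_iff)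
      then have "poly (odd_poly R) x = - poly (odd_poly R) x0" by (simp add: poly_odd_poly)
      then show False using root x0_root by linarith
    qed
    then show "\<exists>j\<in>{1..<k - 1}. x\<^sup>2 = (x0 * y j / y (k - 1))\<^sup>2"
      using j(1) x2 by (intro bexI[of _ j]) auto
  qed
qed

text \<open>\<open>1 + odd_poly P\<close> and \<open>1 + odd_poly Q\<close> share a double zero at
  \<open>x0\<close>. After removal of \<open>(x - x0)^2\<close>, the cofactor \<open>h\<close> of
  the first is nonnegative on \<open>[-1, 1]\<close> and the cofactor \<open>g\<close> of the second
  is positive wherever \<open>h\<close> vanishes there, so \<open>h + e * g\<close> is positive for
  small \<open>e\<close>.\<close>

lemma unique_contact_poly:
  fixes k :: nat and x0 :: real
  assumes k: "k \<ge> 2" and x0: "cos (real (k - 1) * pi / real (2 * k - 1)) < x0" "x0 \<le> 1"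
  obtains C :: real and R :: "real poly" where "degree R < k"
    "\<And>x. \<bar>x\<bar> \<le> 1 \<Longrightarrow> C + x * poly R (x\<^sup>2) \<ge> 0"
    "\<And>x. \<bar>x\<bar> \<le> 1 \<Longrightarrow> C + x * poly R (x\<^sup>2) = 0 \<longleftrightarrow> x = x0"
proof -
  define y where "y j = cos (real j * pi / real (2 * k - 1))" for j
  have ypos: "y j > 0" if "j < k" for j using cos_node_pos[OF that] by (simp add: y_def)
  have x0pos: "x0 > 0" using ypos[of "k - 1"] x0 k by (simp add: y_def)
  obtain P where P: "degree P < k"
    "\<And>x. \<bar>x\<bar> \<le> 1 \<Longrightarrow> 1 + poly (odd_poly P) x \<ge> 0"
    "1 + poly (odd_poly P) x0 = 0" "poly (pderiv (odd_poly P)) x0 = 0"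
    "poly (pderiv (pderiv (odd_poly P))) x0 > 0"
    "\<And>x. \<bar>x\<bar> \<le> 1 \<Longrightarrow> 1 + poly (odd_poly P) x = 0 \<Longrightarrow> x \<noteq> x0 \<Longrightarrow>
       \<exists>j\<in>{1..<k - 1}. x\<^sup>2 = (x0 * y j / y (k - 1))\<^sup>2"
    by (rule scaled_chebyshev[OF k x0(1), folded y_def]) (rule that)
  have nodes: "(x0 * y j / y (k - 1))\<^sup>2 \<noteq> x0\<^sup>2" if "j \<in> {1..<k - 1}" for j
  proof -
    have "y (k - 1) < y j" unfolding y_def using that by (intro cos_node_less) auto
    then have "x0 < x0 * y j / y (k - 1)" using x0pos ypos[of "k - 1"] k by (simp add: field_simps)
    then have "x0\<^sup>2 < (x0 * y j / y (k - 1))\<^sup>2" using x0pos by (intro power_strict_mono) auto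
    then show ?thesis by simp
  qed
  obtain Q where Q: "degree Q \<le> card {1..<k - 1} + 1" "poly (odd_poly Q) x0 = -1"
      "poly (pderiv (odd_poly Q)) x0 = 0"
      "\<And>j x. j \<in> {1..<k - 1} \<Longrightarrow> x\<^sup>2 = (x0 * y j / y (k - 1))\<^sup>2 \<Longrightarrow> poly (odd_poly Q) x = 0"
    using correction_poly[of "{1..<k - 1}" x0 "\<lambda>j. (x0 * y j / y (k - 1))\<^sup>2"] nodes x0pos by auto
  obtain h where h: "1 + odd_poly P = [:- x0, 1:]\<^sup>2 * h"
      "poly (pderiv (pderiv (1 + odd_poly P))) x0 = 2 * poly h x0"
    by (rule double_root_factor[of "1 + odd_poly P" x0]) (use P in \<open>auto simp: pderiv_add\<close>)
  obtain g where g: "1 + odd_poly Q = [:- x0, 1:]\<^sup>2 * g"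
    by (rule double_root_factor[of "1 + odd_poly Q" x0]) (use Q in \<open>auto simp: pderiv_add\<close>)
  have h_eval: "1 + poly (odd_poly P) x = (x - x0)\<^sup>2 * poly h x" for x
    using arg_cong[OF h(1), of "\<lambda>p. poly p x"] by simp
  have g_eval: "1 + poly (odd_poly Q) x = (x - x0)\<^sup>2 * poly g x" for x
    using arg_cong[OF g, of "\<lambda>p. poly p x"] by simp
  have h0: "poly h x0 > 0" using h(2) P(5) by (simp add: pderiv_add)
  obtain e where e: "e > 0" "\<And>x. x \<in> {-1..1} \<Longrightarrow> poly h x + e * poly g x > 0"
  proof (rule small_perturbation_pos[of "{-1..1::real}" "poly h" "poly g"])
    fix x :: real assume "x \<in> {-1..1}"
    then have x: "\<bar>x\<bar> \<le> 1" by auto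
    show "poly h x \<ge> 0"
    proof (cases "x = x0")
      case False
      then show ?thesis using P(2)[OF x] unfolding h_eval by (simp add: zero_le_mult_iff)
    qed (use h0 in simp)
    assume hx: "poly h x = 0"
    then have "x \<noteq> x0" using h0 by auto
    moreover have "1 + poly (odd_poly P) x = 0" unfolding h_eval hx by simp
    \<comment> \<open>The remaining zeros of \<open>1 + odd_poly P\<close> are zeros of
      \<open>odd_poly Q\<close>, so \<open>1 + odd_poly Q\<close> has the value 1 there.\<close>
    ultimately have "poly (odd_poly Q) x = 0" using P(6)[OF x] Q(4) by blast
    then have "(x - x0)\<^sup>2 * poly g x = 1" using g_eval[of x] by simp
    then have "(x - x0)\<^sup>2 * poly g x > 0" by simp
    then show "poly g x > 0" by (simp add: zero_less_mult_iff)
  qed (auto intro!: continuous_intros)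
  have eval: "(1 + e) + x * poly (P + smult e Q) (x\<^sup>2) = (x - x0)\<^sup>2 * (poly h x + e * poly g x)" for x
  proof -
    have "(1 + e) + x * poly (P + smult e Q) (x\<^sup>2) =
        (1 + poly (odd_poly P) x) + e * (1 + poly (odd_poly Q) x)"
      by (simp add: poly_odd_poly algebra_simps)
    also have "\<dots> = (x - x0)\<^sup>2 * (poly h x + e * poly g x)"
      unfolding h_eval g_eval by (simp add: algebra_simps)
    finally show ?thesis .
  qed
  show ?thesis
  proof (rule that[of "P + smult e Q" "1 + e"])
    \<comment> \<open>\<open>{1..<k - 1}\<close> has \<open>k - 2\<close> elements, so the degree of
      \<open>Q\<close> just fits the frequencies of the curve.\<close>
    have "degree (smult e Q) \<le> k - 1" using Q(1) k degree_smult_le[of e Q] by auto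
    then show "degree (P + smult e Q) < k" using P(1) k by (intro degree_add_less) auto
    fix x :: real assume "\<bar>x\<bar> \<le> 1"
    then have pos: "poly h x + e * poly g x > 0" by (intro e(2)) auto
    show "(1 + e) + x * poly (P + smult e Q) (x\<^sup>2) \<ge> 0"
      unfolding eval using pos by simp
    show "(1 + e) + x * poly (P + smult e Q) (x\<^sup>2) = 0 \<longleftrightarrow> x = x0"
      unfolding eval using pos by simp
  qed
qed

lemma cos_eq_cis: "cos x = cos y \<longleftrightarrow> cis x = cis y \<or> cis x = cis (- y)"
proof
  assume "cos x = cos y"
  then have "(sin x)\<^sup>2 = (sin y)\<^sup>2" by (simp add: sin_squared_eq)
  with \<open>cos x = cos y\<close> show "cis x = cis y \<or> cis x = cis (- y)"
    by (auto simp: complex_eq_iff power2_eq_iff)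
qed (auto simp: complex_eq_iff)

lemma cis_shift: "cis x = cis (c + y) \<longleftrightarrow> cis (x - c) = cis y"
proof -
  have "cis x = cis c * cis (x - c)" by (simp add: cis_mult)
  then show ?thesis by (simp flip: cis_mult)
qed

text \<open>The contact polynomial in \<open>cos (\<theta> - c)\<close> is the required functional:
  its only zero \<open>cos t\<close> is attained exactly at \<open>c - t\<close> and
  \<open>c + t\<close> up to full turns.\<close>

lemma exposed_edge_of_orbitope_arc:
  fixes c :: real
  assumes card: "CARD('n::{finite,linorder}) = 2 * k" and k: "k \<ge> 2"
    and t: "cos (real (k - 1) * pi / real (2 * k - 1)) < cos t" "cis (c - t) \<noteq> cis (c + t)"
  shows "closed_segment (SM k (c - t)) (SM k (c + t)) exposed_edge_of
    (orbitope k :: (real ^ 'n::{finite,linorder}) set)"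
proof -
  obtain C and R :: "real poly" where R: "degree R < k"
    "\<And>x. \<bar>x\<bar> \<le> 1 \<Longrightarrow> C + x * poly R (x\<^sup>2) \<ge> 0"
    "\<And>x. \<bar>x\<bar> \<le> 1 \<Longrightarrow> C + x * poly R (x\<^sup>2) = 0 \<longleftrightarrow> x = cos t"
    by (rule unique_contact_poly[OF k t(1) cos_le_one]) (rule that)
  obtain a :: "real ^ 'n::{finite,linorder}"
    where a: "\<And>\<theta>. a \<bullet> SM k \<theta> = cos (\<theta> - c) * poly R ((cos (\<theta> - c))\<^sup>2)"
    using odd_poly_as_inner_SM[OF card R(1)] by blast
  show ?thesis
  proof (rule exposed_edge_of_orbitope[OF card _ t(2), where a = a and C = C])
    show "k \<ge> 1" using k by simp
    fix \<theta>
    show "C + a \<bullet> SM k \<theta> \<ge> 0" unfolding a by (intro R(2)) simp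
    have "C + a \<bullet> SM k \<theta> = 0 \<longleftrightarrow> cos (\<theta> - c) = cos t" unfolding a by (intro R(3)) simp
    also have "\<dots> \<longleftrightarrow> cis \<theta> = cis (c - t) \<or> cis \<theta> = cis (c + t)"
      using cis_shift[of \<theta> c t] cis_shift[of \<theta> c "- t"] by (auto simp: cos_eq_cis)
    finally show "C + a \<bullet> SM k \<theta> = 0 \<longleftrightarrow> cis \<theta> = cis (c - t) \<or> cis \<theta> = cis (c + t)" .
  qed
qed

subsection \<open>Edges of the orbitope\<close>

text \<open>\<open>c\<close> is the centre of the shorter arc: the mean of the two angles, moved by
  \<open>pi\<close> if the direct arc is the longer one. Sets are compared because the order of the
  endpoints along the arc varies.\<close>

lemma arc_midpoint:
  assumes "\<alpha> \<in> {0..2 * pi}" "\<beta> \<in> {0..2 * pi}" "cis \<alpha> \<noteq> cis \<beta>"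
  obtains c where "{cis \<alpha>, cis \<beta>} = {cis (c - shorter_arc_length \<alpha> \<beta> / 2), cis (c + shorter_arc_length \<alpha> \<beta> / 2)}"
proof -
  have *: "\<exists>c. {cis \<alpha>, cis \<beta>} = {cis (c - shorter_arc_length \<alpha> \<beta> / 2), cis (c + shorter_arc_length \<alpha> \<beta> / 2)}"
    if "\<alpha> \<le> \<beta>" for \<alpha> \<beta>
  proof (cases "\<beta> - \<alpha> \<le> pi")
    case True
    then have len: "shorter_arc_length \<alpha> \<beta> / 2 = (\<beta> - \<alpha>) / 2"
      using that by (simp add: shorter_arc_length_def)
    have "(\<alpha> + \<beta>) / 2 - (\<beta> - \<alpha>) / 2 = \<alpha>" "(\<alpha> + \<beta>) / 2 + (\<beta> - \<alpha>) / 2 = \<beta>"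
      by (simp_all add: field_simps)
    then show ?thesis unfolding len by metis
  next
    case False
    then have len: "shorter_arc_length \<alpha> \<beta> / 2 = pi - (\<beta> - \<alpha>) / 2"
      using that by (simp add: shorter_arc_length_def field_simps)
    define c where "c = (\<alpha> + \<beta>) / 2 + pi"
    have "c - shorter_arc_length \<alpha> \<beta> / 2 = \<beta>" "c + shorter_arc_length \<alpha> \<beta> / 2 = \<alpha> + 2 * pi"
      by (simp_all add: len c_def field_simps)
    moreover have "cis (\<alpha> + 2 * pi) = cis \<alpha>" by (simp flip: cis_mult)
    ultimately show ?thesis by (intro exI[of _ c]) auto
  qed
  show ?thesis
  proof (cases "\<alpha> \<le> \<beta>")
    case True
    then show ?thesis using *[OF True] that by blast
  next
    case False
    then have "\<beta> \<le> \<alpha>" by simp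
    from *[OF this] show ?thesis
      using that by (auto simp: shorter_arc_length_def abs_minus_commute insert_commute)
  qed
qed

theorem theorem1:
  fixes k :: nat and \<alpha> \<beta> :: real
    and B :: "(real ^ 'n::{finite,linorder}) set"
  assumes "k \<ge> 1"
    and "CARD('n) = 2 * k"
    and "\<alpha> \<in> {0..2 * pi}" and "\<beta> \<in> {0..2 * pi}"
    and "cis \<alpha> \<noteq> cis \<beta>"
    and "B = orbitope k"
  shows "(shorter_arc_length \<alpha> \<beta> < 2 * pi * (real k - 1) / (2 * real k - 1)
            \<longrightarrow> closed_segment (SM k \<alpha>) (SM k \<beta>) exposed_edge_of B)
       \<and> (shorter_arc_length \<alpha> \<beta> > 2 * pi * (real k - 1) / (2 * real k - 1)
            \<longrightarrow> \<not> closed_segment (SM k \<alpha>) (SM k \<beta>) edge_of B)"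
proof -
  define t where "t = shorter_arc_length \<alpha> \<beta> / 2"
  obtain c where c: "{cis \<alpha>, cis \<beta>} = {cis (c - t), cis (c + t)}"
    using arc_midpoint[OF assms(3-5)] unfolding t_def by blast
  have cis_neq: "cis (c - t) \<noteq> cis (c + t)" using c assms(5) by auto
  have segment: "closed_segment (SM k \<alpha>) (SM k \<beta>) =
      (closed_segment (SM k (c - t)) (SM k (c + t)) :: (real ^ 'n::{finite,linorder}) set)"
  proof -
    from c consider "cis \<alpha> = cis (c - t)" "cis \<beta> = cis (c + t)" | "cis \<alpha> = cis (c + t)" "cis \<beta> = cis (c - t)"
      by (auto simp: doubleton_eq_iff)
    then show ?thesis
      by cases (metis SM_cong_cis, metis SM_cong_cis closed_segment_commute)
  qed
  have t: "0 \<le> t" "t \<le> pi / 2"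
    using assms(3,4) by (auto simp: t_def shorter_arc_length_def min_def abs_if split: if_splits)
  define \<phi>0 where "\<phi>0 = real (k - 1) * pi / real (2 * k - 1)"
  \<comment> \<open>For \<open>k \<ge> 1\<close> the truncated subtractions on naturals agree with
    the real ones.\<close>
  have \<phi>0: "2 * pi * (real k - 1) / (2 * real k - 1) = 2 * \<phi>0"
    using assms(1) by (simp add: \<phi>0_def of_nat_diff)
  have "real (k - 1) \<le> real (2 * k - 1)" by simp
  then have \<phi>0_bounds: "0 \<le> \<phi>0" "\<phi>0 \<le> pi"
    using assms(1) by (auto simp: \<phi>0_def divide_le_eq mult_right_mono)
  show ?thesis
    unfolding segment \<phi>0 assms(6)
  proof (intro conjI impI)
    assume "shorter_arc_length \<alpha> \<beta> < 2 * \<phi>0"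
    then have lt: "t < \<phi>0" by (simp add: t_def)
    \<comment> \<open>For \<open>k = 1\<close> the threshold is 0, and no arc is shorter than
      that.\<close>
    then have "k \<noteq> 1" using t by (auto simp: \<phi>0_def)
    then have "k \<ge> 2" using assms(1) by simp
    moreover have "cos \<phi>0 < cos t" using t lt \<phi>0_bounds by (intro cos_monotone_0_pi)
    ultimately show "closed_segment (SM k (c - t)) (SM k (c + t)) exposed_edge_of (orbitope k :: (real ^ 'n::{finite,linorder}) set)"
      using exposed_edge_of_orbitope_arc[OF assms(2)] cis_neq unfolding \<phi>0_def by blast
  next
    assume "shorter_arc_length \<alpha> \<beta> > 2 * \<phi>0"
    then have "\<phi>0 < t" by (simp add: t_def)
    then have "cos t < cos \<phi>0" using t \<phi>0_bounds by (intro cos_monotone_0_pi) auto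
    moreover have "cos t \<ge> 0" using t by (intro cos_ge_zero) auto
    ultimately show "\<not> closed_segment (SM k (c - t)) (SM k (c + t)) edge_of (orbitope k :: (real ^ 'n::{finite,linorder}) set)"
      using not_face_of_orbitope[OF assms(2,1), of t c] unfolding edge_of_def \<phi>0_def by blast
  qed
qed

end
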